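(* Let $(X,\mathcal{F})$ be a reflexive differential space, equipped with the initial topology of $\mathcal{F}$. Then $X$ is locally smoothly path-connected: for every $x\in X$ and every open neighbourhood $U$ of $x$, there is a neighbourhood of $x$ contained in $U$ that is smoothly path-connected.
   Context: The initial topology of a family $\mathcal{F}$ of real-valued functions on a set is the weakest topology for which all functions in $\mathcal{F}$ are continuous. A differential structure on a nonempty set $X$ is a nonempty family $\mathcal{F}$ of functions $X\to\mathbb{R}$, along with its initial topology, such that: (1) (Smooth compatibility) for any positive integer $k$, $f_1,\dots,f_k\in\mathcal{F}$ and $F\in C^\infty(\mathbb{R}^k)$, the composition $F(f_1,\dots,f_k)$ is in $\mathcal{F}$; (2) (Locality) if $f\colon X\to\mathbb{R}$ is such that every $x\in X$ has an open neighbourhood $U$ (in the initial topology) and some $g\in\mathcal{F}$ with $f|_U=g|_U$, then $f\in\mathcal{F}$. A differential space is a nonempty set with a differential structure. A parametrisation of $X$ is a function $p\colon U\to X$ where $U$ is an open subset of $\mathbb{R}^n$ for some $n$. For a set $\mathcal{D}_0$ of parametrisations of $X$, $\Phi\mathcal{D}_0:=\{f\colon X\to\mathbb{R} \mid f\circ p\in C^\infty(U)\text{ for all }(p\colon U\to X)\in\mathcal{D}_0\}$. For a set $\mathcal{F}_0$ of real-valued functions on $X$, $\Pi\mathcal{F}_0:=\{\text{parametrisations }p\colon U\to X \mid f\circ p\in C^\infty(U)\text{ for all }f\in\mathcal{F}_0\}$. A differential structure $\mathcal{F}$ is reflexive if $\Phi\Pi\mathcal{F}=\mathcal{F}$. A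 subset $V\subseteq X$ is smoothly path-connected if for all $y,z\in V$ there is a curve $\gamma\colon\mathbb{R}\to X$ with image in $V$, $\gamma(0)=y$, $\gamma(1)=z$, such that $f\circ\gamma\in C^\infty(\mathbb{R})$ for all $f\in\mathcal{F}$. *)

theory Defs
  imports "HOL-Analysis.Analysis"
begin

section \<open>Smooth functions\<close>

text \<open>
  The space of real \<open>n\<close>-tuples is \<^const>\<open>Euclidean_space\<close> \<open>n\<close>: the sequences \<open>x :: nat \<Rightarrow> real\<close>
  with \<open>x i = 0\<close> for \<open>i \<ge> n\<close>. This allows quantification over \<open>n\<close> within a definition.

  \<open>Ck_on n k U f\<close>, for \<open>U\<close> open in \<open>Euclidean_space n\<close>, says that all partial derivatives of \<open>f\<close>
  of order at most \<open>k\<close> exist and are continuous on \<open>U\<close>. The function \<open>g\<close> is the \<open>i\<close>-th partial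
  derivative of \<open>f\<close>. Values of \<open>f\<close> outside \<open>U\<close> are irrelevant because \<open>U\<close> is open.
\<close>

primrec Ck_on :: "nat \<Rightarrow> nat \<Rightarrow> (nat \<Rightarrow> real) set \<Rightarrow> ((nat \<Rightarrow> real) \<Rightarrow> real) \<Rightarrow> bool" where
  "Ck_on n 0 U f \<longleftrightarrow> continuous_map (subtopology (Euclidean_space n) U) euclideanreal f"
| "Ck_on n (Suc k) U f \<longleftrightarrow>
     continuous_map (subtopology (Euclidean_space n) U) euclideanreal f \<and>
     (\<forall>i<n. \<exists>g. (\<forall>x\<in>U. ((\<lambda>t. f (x(i := t))) has_real_derivative g x) (at (x i))) \<and>
                Ck_on n k U g)"

definition smooth_on :: "nat \<Rightarrow> (nat \<Rightarrow> real) set \<Rightarrow> ((nat \<Rightarrow> real) \<Rightarrow> real) \<Rightarrow> bool" where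
  "smooth_on n U f \<longleftrightarrow> (\<forall>k. Ck_on n k U f)"

definition smooth_real :: "(real \<Rightarrow> real) \<Rightarrow> bool" where
  "smooth_real g \<longleftrightarrow> (\<forall>k t. (deriv ^^ k) g differentiable (at t))"


section \<open>Differential spaces\<close>

text \<open>
  Functions from a set \<open>X\<close> to the reals are elements of \<open>X \<rightarrow>\<^sub>E UNIV\<close>, that is, they take
  the value \<open>undefined\<close> outside \<open>X\<close>, so that equality of functions is equality on \<open>X\<close>.
\<close>

definition initial_topology :: "'a set \<Rightarrow> ('a \<Rightarrow> real) set \<Rightarrow> 'a topology" where
  "initial_topology X F =
     topology_generated_by (insert X {{x \<in> X. f x \<in> S} | f S. f \<in> F \<and> open S})"

lemma topspace_initial_topology [simp]: "topspace (initial_topology X F) = X"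
  by (auto simp: initial_topology_def)

lemma continuous_map_initial_topology:
  assumes "f \<in> F"
  shows "continuous_map (initial_topology X F) euclideanreal f"
proof -
  have "openin (initial_topology X F) {x \<in> X. f x \<in> S}" if "open S" for S
    unfolding initial_topology_def
    by (rule topology_generated_by_Basis) (use assms that in blast)
  then show ?thesis
    by (simp add: continuous_map)
qed

lemma initial_topology_weakest:
  assumes "topspace T = X" and "\<And>f. f \<in> F \<Longrightarrow> continuous_map T euclideanreal f"
    and "openin (initial_topology X F) U"
  shows "openin T U"
proof -
  have *: "openin T B" if "B \<in> insert X {{x \<in> X. f x \<in> S} | f S. f \<in> F \<and> open S}" for B
    using that assms(1,2) by (auto simp: continuous_map)
  have "generate_topology_on (insert X {{x \<in> X. f x \<in> S} | f S. f \<in> F \<and> open S}) U"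
    using assms(3) by (simp add: initial_topology_def openin_topology_generated_by_iff)
  then show ?thesis
  proof (induction rule: generate_topology_on.induct)
    case (Basis B)
    then show ?case by (rule *)
  qed (simp_all add: openin_Int openin_Union)
qed

definition smooth_compatibility :: "'a set \<Rightarrow> ('a \<Rightarrow> real) set \<Rightarrow> bool" where
  "smooth_compatibility X F \<longleftrightarrow>
     (\<forall>k>0. \<forall>f :: nat \<Rightarrow> 'a \<Rightarrow> real. \<forall>G. (\<forall>i<k. f i \<in> F) \<and>
        smooth_on k (topspace (Euclidean_space k)) G \<longrightarrow>
        (\<lambda>x\<in>X. G (\<lambda>i. if i < k then f i x else 0)) \<in> F)"

definition locality :: "'a set \<Rightarrow> ('a \<Rightarrow> real) set \<Rightarrow> bool" where
  "locality X F \<longleftrightarrow>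
     (\<forall>f \<in> X \<rightarrow>\<^sub>E UNIV.
        (\<forall>x\<in>X. \<exists>U g. openin (initial_topology X F) U \<and> x \<in> U \<and> g \<in> F \<and> (\<forall>y\<in>U. f y = g y))
        \<longrightarrow> f \<in> F)"

definition differential_space :: "'a set \<Rightarrow> ('a \<Rightarrow> real) set \<Rightarrow> bool" where
  "differential_space X F \<longleftrightarrow>
     X \<noteq> {} \<and> F \<noteq> {} \<and> F \<subseteq> X \<rightarrow>\<^sub>E UNIV \<and> smooth_compatibility X F \<and> locality X F"


section \<open>Parametrisations and reflexivity\<close>

text \<open>A triple \<open>(n, U, p)\<close> represents the parametrisation \<open>p : U \<rightarrow> X\<close> with \<open>U\<close> open in \<open>n\<close>-space.\<close>

type_synonym 'a param = "nat \<times> (nat \<Rightarrow> real) set \<times> ((nat \<Rightarrow> real) \<Rightarrow> 'a)"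

definition parametrisations :: "'a set \<Rightarrow> 'a param set" where
  "parametrisations X = {(n, U, p). openin (Euclidean_space n) U \<and> p \<in> U \<rightarrow>\<^sub>E X}"

definition Phi :: "'a set \<Rightarrow> 'a param set \<Rightarrow> ('a \<Rightarrow> real) set" where
  "Phi X D = {f \<in> X \<rightarrow>\<^sub>E UNIV. \<forall>(n, U, p) \<in> D. smooth_on n U (f \<circ> p)}"

definition Pi_param :: "'a set \<Rightarrow> ('a \<Rightarrow> real) set \<Rightarrow> 'a param set" where
  "Pi_param X F = {(n, U, p) \<in> parametrisations X. \<forall>f\<in>F. smooth_on n U (f \<circ> p)}"

definition reflexive :: "'a set \<Rightarrow> ('a \<Rightarrow> real) set \<Rightarrow> bool" where
  "reflexive X F \<longleftrightarrow> Phi X (Pi_param X F) = F"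


section \<open>Smooth path-connectedness\<close>

definition smoothly_path_connected :: "'a set \<Rightarrow> ('a \<Rightarrow> real) set \<Rightarrow> 'a set \<Rightarrow> bool" where
  "smoothly_path_connected X F V \<longleftrightarrow>
     V \<subseteq> X \<and>
     (\<forall>y\<in>V. \<forall>z\<in>V. \<exists>\<gamma> :: real \<Rightarrow> 'a. range \<gamma> \<subseteq> V \<and> \<gamma> 0 = y \<and> \<gamma> 1 = z \<and>
        (\<forall>f\<in>F. smooth_real (f \<circ> \<gamma>)))"

definition locally_smoothly_path_connected :: "'a set \<Rightarrow> ('a \<Rightarrow> real) set \<Rightarrow> bool" where
  "locally_smoothly_path_connected X F \<longleftrightarrow>
     neighbourhood_base_of (smoothly_path_connected X F) (initial_topology X F)"

lemma locally_smoothly_path_connected_iff: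
  "locally_smoothly_path_connected X F \<longleftrightarrow>
     (\<forall>x\<in>X. \<forall>U. openin (initial_topology X F) U \<and> x \<in> U \<longrightarrow>
        (\<exists>W V. openin (initial_topology X F) W \<and> smoothly_path_connected X F V \<and>
               x \<in> W \<and> W \<subseteq> V \<and> V \<subseteq> U))" (is "_ \<longleftrightarrow> ?R")
proof
  assume "locally_smoothly_path_connected X F"
  then show ?R
    unfolding locally_smoothly_path_connected_def neighbourhood_base_of by simp
next
  assume R: ?R
  show "locally_smoothly_path_connected X F"
    unfolding locally_smoothly_path_connected_def neighbourhood_base_of
  proof (intro allI impI)
    fix U x
    assume *: "openin (initial_topology X F) U \<and> x \<in> U"
    then have "x \<in> X"
      using openin_subset[of "initial_topology X F" U] by auto
    from R[rule_format, OF this *]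
    show "\<exists>W V. openin (initial_topology X F) W \<and> smoothly_path_connected X F V \<and>
             x \<in> W \<and> W \<subseteq> V \<and> V \<subseteq> U" .
  qed
qed

end

theory Submission
  imports Defs
begin

text \<open>
  Let \<open>U\<close> be an open neighbourhood of \<open>x\<close>, and let \<open>C\<close> be the smooth path component of \<open>x\<close>
  in \<open>U\<close>: the points that a smooth curve inside \<open>U\<close> joins to \<open>x\<close>. Smooth curves can be reversed,
  and they can be concatenated after being slowed down at the joint, so \<open>C\<close> is smoothly
  path-connected (\<open>smoothly_path_connected_component\<close>). It remains to see why \<open>C\<close> is a
  neighbourhood of \<open>x\<close>.

  This is where reflexivity enters: it says that a function belongs to \<open>F\<close> as soon as its composition
  with every plot \<open>p\<close>, that is, every member of \<open>\<Pi> F\<close>, is smooth. A plot pulls \<open>U\<close> back to an open set,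
  and on a small box in there any two points are joined by a chain of axis-parallel segments, whose
  images under \<open>p\<close> are smooth curves in \<open>U\<close> (\<open>smoothly_joined_plot_box\<close>). Hence the
  indicator function of \<open>C\<close>, composed with \<open>p\<close>, is locally constant on the preimage of \<open>U\<close>. Take a bump
  function \<open>g \<in> F\<close> with \<open>g x \<noteq> 0\<close> that vanishes on an open set containing the complement of \<open>U\<close>
  (\<open>bump_function_exists\<close>), and let \<open>h\<close> agree with \<open>g\<close> on \<open>C\<close> and vanish elsewhere. Then \<open>h \<circ> p\<close> is
  locally \<open>g \<circ> p\<close> or \<open>0\<close>: on the preimage of \<open>U\<close> because the indicator is locally constant there, and
  near all other points because \<open>g\<close> vanishes. So \<open>h\<close> lies in \<open>F\<close>, and the open set \<open>h \<noteq> 0\<close>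
  contains \<open>x\<close> and is contained in \<open>C\<close>.

  Using axis-parallel segments only means that the smoothness of \<open>f \<circ> p\<close> along a segment is a
  statement about iterated partial derivatives in a single direction, so that no chain rule for
  functions of several variables is involved.
\<close>

section \<open>Smooth functions of one real variable\<close>

text \<open>
  A finite order of differentiability, on a set, makes smoothness accessible to induction on the
  order and allows it to be checked on the pieces of an open cover.
\<close>

definition diff_upto :: "nat \<Rightarrow> real set \<Rightarrow> (real \<Rightarrow> real) \<Rightarrow> bool" where
  "diff_upto k S f \<longleftrightarrow> (\<forall>j<k. \<forall>t\<in>S. (deriv ^^ j) f differentiable (at t))"

lemma smooth_real_iff_diff_upto: "smooth_real f \<longleftrightarrow> (\<forall>k. diff_upto k UNIV f)"
  by (auto simp: smooth_real_def diff_upto_def)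

lemma diff_upto_0 [simp]: "diff_upto 0 S f"
  by (simp add: diff_upto_def)

lemma diff_upto_Suc:
  "diff_upto (Suc k) S f \<longleftrightarrow> (\<forall>t\<in>S. f differentiable (at t)) \<and> diff_upto k S (deriv f)"
  unfolding diff_upto_def All_less_Suc2 funpow_Suc_right by simp

lemma diff_upto_if_Suc: "diff_upto (Suc k) S f \<Longrightarrow> diff_upto k S f"
  by (simp add: diff_upto_def)

lemma diff_upto_subset: "diff_upto k S f \<Longrightarrow> T \<subseteq> S \<Longrightarrow> diff_upto k T f"
  by (auto simp: diff_upto_def)

lemma diff_upto_Un: "diff_upto k S f \<Longrightarrow> diff_upto k T f \<Longrightarrow> diff_upto k (S \<union> T) f"
  by (auto simp: diff_upto_def)

lemma diff_upto_SucD: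
  assumes "diff_upto (Suc k) S f" "t \<in> S"
  shows "(f has_real_derivative deriv f t) (at t)"
  using assms by (simp add: diff_upto_Suc DERIV_deriv_iff_real_differentiable)

lemma diff_upto_cong:
  assumes "open S" "\<And>t. t \<in> S \<Longrightarrow> f t = g t" "diff_upto k S f"
  shows "diff_upto k S g"
  using assms(2,3)
proof (induction k arbitrary: f g)
  case (Suc k)
  have der: "(g has_real_derivative deriv f t) (at t)" if "t \<in> S" for t
    using has_field_derivative_transform_within_open[OF diff_upto_SucD[OF Suc.prems(2) that] \<open>open S\<close> that]
      Suc.prems(1) by blast
  have "diff_upto k S (deriv g)"
    by (rule Suc.IH[of "deriv f"])
      (use DERIV_imp_deriv[OF der] Suc.prems(2) in \<open>auto simp: diff_upto_Suc\<close>)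
  with der show ?case
    by (auto simp: diff_upto_Suc real_differentiable_def)
qed simp

text \<open>
  An explicit derivative \<open>g\<close> on an open set can stand in for \<^const>\<open>deriv\<close>, since the two agree
  on a neighbourhood of each point of the set.
\<close>

lemma diff_upto_SucI:
  assumes "open S" "\<And>t. t \<in> S \<Longrightarrow> (f has_real_derivative g t) (at t)" "diff_upto k S g"
  shows "diff_upto (Suc k) S f"
proof -
  have "diff_upto k S (deriv f)"
    by (rule diff_upto_cong[OF assms(1) _ assms(3)]) (use DERIV_imp_deriv[OF assms(2)] in auto)
  then show ?thesis
    using assms(2) by (auto simp: diff_upto_Suc real_differentiable_def)
qed

lemma diff_upto_const: "open S \<Longrightarrow> diff_upto k S (\<lambda>t. c)"
proof (induction k arbitrary: c)
  case (Suc k)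
  then show ?case
    by (intro diff_upto_SucI[where g = "\<lambda>t. 0"]) auto
qed simp

lemma diff_upto_id: "open S \<Longrightarrow> diff_upto k S (\<lambda>t. t)"
  by (cases k) (auto intro: diff_upto_SucI[where g = "\<lambda>t. 1"] diff_upto_const)

lemma diff_upto_add:
  assumes "open S" "diff_upto k S f" "diff_upto k S g"
  shows "diff_upto k S (\<lambda>t. f t + g t)"
  using assms(2,3)
proof (induction k arbitrary: f g)
  case (Suc k)
  have "diff_upto k S (\<lambda>t. deriv f t + deriv g t)"
    using Suc by (simp add: diff_upto_Suc)
  then show ?case
    by (rule diff_upto_SucI[OF \<open>open S\<close> DERIV_add[OF diff_upto_SucD diff_upto_SucD], rotated -1])
      (rule Suc.prems | assumption)+
qed simp

lemma diff_upto_mult: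
  assumes "open S" "diff_upto k S f" "diff_upto k S g"
  shows "diff_upto k S (\<lambda>t. f t * g t)"
  using assms(2,3)
proof (induction k arbitrary: f g)
  case (Suc k)
  have "diff_upto k S f" "diff_upto k S g"
    using Suc.prems by (simp_all add: diff_upto_if_Suc)
  moreover have "diff_upto k S (deriv f)" "diff_upto k S (deriv g)"
    using Suc.prems by (auto simp: diff_upto_Suc)
  ultimately have "diff_upto k S (\<lambda>t. deriv f t * g t + deriv g t * f t)"
    by (intro diff_upto_add Suc.IH \<open>open S\<close>)
  then show ?case
    by (rule diff_upto_SucI[OF \<open>open S\<close> DERIV_mult[OF diff_upto_SucD diff_upto_SucD], rotated -1])
      (rule Suc.prems | assumption)+
qed simp

lemma diff_upto_compose:
  assumes "open S" "open T" "s ` T \<subseteq> S" "diff_upto k S f" "diff_upto k T s"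
  shows "diff_upto k T (\<lambda>t. f (s t))"
  using assms(4,5)
proof (induction k arbitrary: f)
  case (Suc k)
  have "diff_upto k T s"
    using Suc.prems by (simp add: diff_upto_if_Suc)
  moreover have "diff_upto k S (deriv f)" "diff_upto k T (deriv s)"
    using Suc.prems by (auto simp: diff_upto_Suc)
  ultimately have "diff_upto k T (\<lambda>t. deriv f (s t) * deriv s t)"
    using diff_upto_mult[OF \<open>open T\<close> Suc.IH] by blast
  moreover have "((\<lambda>t. f (s t)) has_real_derivative deriv f (s t) * deriv s t) (at t)" if "t \<in> T" for t
    using that assms(3)
    by (intro DERIV_chain2[OF diff_upto_SucD[OF Suc.prems(1)] diff_upto_SucD[OF Suc.prems(2)]]) auto
  ultimately show ?case
    by (rule diff_upto_SucI[OF \<open>open T\<close>, rotated])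
qed simp

lemma smooth_real_const: "smooth_real (\<lambda>t. c)"
  by (simp add: smooth_real_iff_diff_upto diff_upto_const)

lemma smooth_real_affine: "smooth_real (\<lambda>t. a + b * t)"
  by (simp add: smooth_real_iff_diff_upto diff_upto_const diff_upto_id diff_upto_add diff_upto_mult)

lemma smooth_real_mult: "smooth_real f \<Longrightarrow> smooth_real g \<Longrightarrow> smooth_real (\<lambda>t. f t * g t)"
  by (simp add: smooth_real_iff_diff_upto diff_upto_mult)

lemma smooth_real_compose: "smooth_real f \<Longrightarrow> smooth_real g \<Longrightarrow> smooth_real (\<lambda>t. f (g t))"
  unfolding smooth_real_iff_diff_upto
  using diff_upto_compose[OF open_UNIV open_UNIV subset_UNIV] by blast

lemma smooth_real_deriv: "smooth_real f \<Longrightarrow> smooth_real (deriv f)"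
  unfolding smooth_real_iff_diff_upto by (meson diff_upto_Suc)

lemma smooth_real_imp_DERIV: "smooth_real f \<Longrightarrow> (f has_real_derivative deriv f t) (at t)"
  unfolding smooth_real_iff_diff_upto by (meson diff_upto_SucD UNIV_I)


section \<open>Bump and plateau functions\<close>

text \<open>
  \<open>flat 0\<close> is the classical smooth function \<open>exp (- 1 / t)\<close> for \<open>t > 0\<close>, extended by \<open>0\<close>. Its
  derivatives involve the additional factors \<open>1 / t ^ k\<close>; the span of the functions \<open>flat k\<close> is closed under
  differentiation.
\<close>

definition flat :: "nat \<Rightarrow> real \<Rightarrow> real" where
  "flat k t = (if 0 < t then inverse t ^ k / exp (inverse t) else 0)"

text \<open>
  The exponential dominates: with \<open>s = 1 / t\<close> this is the limit of \<open>s ^ k / exp s\<close> at infinity.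
\<close>

lemma flat_tendsto_0: "((\<lambda>t. flat k t) \<longlongrightarrow> 0) (at 0)"
proof -
  have "((\<lambda>t::real. inverse t ^ k / exp (inverse t)) \<longlongrightarrow> 0) (at_right 0)"
    using filterlim_compose[OF tendsto_power_div_exp_0 filterlim_inverse_at_top_right] .
  then have "((\<lambda>t. flat k t) \<longlongrightarrow> 0) (at_right 0)"
    by (rule Lim_transform_eventually) (auto simp: flat_def eventually_at_filter)
  moreover have "((\<lambda>t. flat k t) \<longlongrightarrow> 0) (at_left 0)"
    by (rule Lim_transform_eventually[OF tendsto_const]) (auto simp: flat_def eventually_at_filter)
  ultimately show ?thesis
    by (simp add: filterlim_at_split)
qed

lemma DERIV_flat:
  "(flat k has_real_derivative flat (k + 2) t + (- real k) * flat (k + 1) t) (at t)"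
proof -
  consider "t < 0" | "t = 0" | "t > 0" by linarith
  then show ?thesis
  proof cases
    case 1
    have "((\<lambda>t. 0) has_real_derivative 0) (at t)"
      by simp
    then have "(flat k has_real_derivative 0) (at t)"
      by (rule has_field_derivative_transform_within_open[of _ _ _ "{..<0}"])
        (use 1 in \<open>auto simp: flat_def\<close>)
    with 1 show ?thesis
      by (simp add: flat_def)
  next
    case 2
    \<comment> \<open>Dividing by \<open>s\<close> raises the exponent, so the difference quotient is \<open>flat (Suc k)\<close>.\<close>
    have "((\<lambda>s. (flat k s - flat k 0) / (s - 0)) \<longlongrightarrow> 0) (at 0)"
      by (rule Lim_transform_eventually[OF flat_tendsto_0[of "Suc k"]])
        (auto simp: flat_def field_simps eventually_at_filter)
    with 2 show ?thesis
      by (simp add: has_field_derivative_iff flat_def)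
  next
    case 3
    have "((\<lambda>t. inverse t ^ k * exp (- inverse t)) has_real_derivative
        flat (k + 2) t + (- real k) * flat (k + 1) t) (at t)"
      using 3
      apply (auto intro!: derivative_eq_intros simp: flat_def exp_minus)
      apply (cases k)
       apply (auto simp: field_simps power2_eq_square)
      done
    then show ?thesis
      by (rule has_field_derivative_transform_within_open[of _ _ _ "{0<..}"])
        (use 3 in \<open>auto simp: flat_def exp_minus field_simps\<close>)
  qed
qed

lemma smooth_real_flat: "smooth_real (flat m)"
proof -
  have "diff_upto k UNIV (flat m)" for k
  proof (induction k arbitrary: m)
    case (Suc k)
    show ?case
      by (rule diff_upto_SucI[OF open_UNIV DERIV_flat])
        (intro diff_upto_add diff_upto_mult diff_upto_const Suc.IH open_UNIV)
  qed simp
  then show ?thesis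
    by (simp add: smooth_real_iff_diff_upto)
qed

lemma flat_0_pos_iff: "0 < flat 0 t \<longleftrightarrow> 0 < t"
  by (simp add: flat_def)

lemma flat_0_mono: "s \<le> t \<Longrightarrow> flat 0 s \<le> flat 0 t"
  by (simp add: flat_def le_imp_inverse_le field_simps)

text \<open>
  The product of a factor vanishing for \<open>t \<le> c - e\<close> and one vanishing for \<open>t \<ge> c + e\<close>.
\<close>

lemma smooth_bump_exists:
  fixes c e :: real
  assumes "0 < e"
  shows "\<exists>b. smooth_real b \<and> b c \<noteq> 0 \<and> (\<forall>t. e < \<bar>t - c\<bar> \<longrightarrow> b t = 0)"
proof (intro exI conjI)
  let ?b = "\<lambda>t. flat 0 ((e - c) + 1 * t) * flat 0 ((e + c) + (-1) * t)"
  show "smooth_real ?b"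
    by (intro smooth_real_mult smooth_real_compose[OF smooth_real_flat] smooth_real_affine)
  show "?b c \<noteq> 0"
    using assms by (simp add: flat_def)
  show "\<forall>t. e < \<bar>t - c\<bar> \<longrightarrow> ?b t = 0"
    by (auto simp: flat_def)
qed

text \<open>
  A step that is constant on both sides can be had from compositions alone, without a quotient of
  functions: \<open>\<psi> (c - \<psi> t)\<close> with \<open>\<psi> = flat 0\<close> is constant for \<open>t \<le> 0\<close>, where the inner \<open>\<psi>\<close> vanishes, and it is
  zero once \<open>\<psi> t \<ge> c\<close>. With \<open>c = \<psi> (1/2)\<close> the latter happens for \<open>t \<ge> 1/2\<close>.
\<close>

lemma smooth_step_exists:
  "\<exists>s. smooth_real s \<and> (\<forall>t\<le>0. s t = 0) \<and> (\<forall>t\<ge>1/2. s t = 1) \<and> (\<forall>t. 0 \<le> s t \<and> s t \<le> 1)"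
proof -
  define c where "c = flat 0 (1/2)"
  have c: "0 < flat 0 c"
    by (simp add: c_def flat_0_pos_iff)
  define s where "s t = 1 + (- 1 / flat 0 c) * flat 0 (c + (-1) * flat 0 t)" for t
  have "smooth_real s"
    unfolding s_def
    by (rule smooth_real_compose[OF smooth_real_affine] smooth_real_compose[OF smooth_real_flat] smooth_real_flat)+
  moreover have "s t = 0" if "t \<le> 0" for t
    using that c by (simp add: s_def flat_def[of 0 t])
  moreover have "s t = 1" if "1/2 \<le> t" for t
  proof -
    have "flat 0 (c - flat 0 t) = 0"
      using flat_0_mono[OF that] unfolding c_def flat_def[of 0 "_ - _"] by simp
    then show ?thesis
      by (simp add: s_def)
  qed
  moreover have "0 \<le> s t \<and> s t \<le> 1" for t
  proof -
    have "0 \<le> flat 0 t" "0 \<le> flat 0 (c - flat 0 t)"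
      by (simp_all add: flat_def)
    moreover from this have "flat 0 (c - flat 0 t) \<le> flat 0 c"
      by (intro flat_0_mono) simp
    ultimately show ?thesis
      using c by (simp add: s_def field_simps)
  qed
  ultimately show ?thesis
    by blast
qed


section \<open>Smooth functions of several variables\<close>

lemma continuous_map_coordinate_line:
  assumes "x \<in> topspace (Euclidean_space n)" "i < n"
  shows "continuous_map euclideanreal (Euclidean_space n) (\<lambda>t. x(i := t))"
proof -
  have "continuous_map euclideanreal euclideanreal (\<lambda>t. (x(i := t)) j)" for j
    by (cases "j = i") auto
  then show ?thesis
    using assms unfolding Euclidean_space_def
    by (auto simp: continuous_map_in_subtopology continuous_map_componentwise_UNIV)
qed

lemma open_coordinate_line:
  assumes "openin (Euclidean_space n) W" "x \<in> topspace (Euclidean_space n)" "i < n"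
  shows "open {t. x(i := t) \<in> W}"
  using openin_continuous_map_preimage[OF continuous_map_coordinate_line[OF assms(2,3)] assms(1)]
  by simp

lemma has_real_derivative_coordinate_cong:
  assumes W: "openin (Euclidean_space n) W" "x \<in> W" "i < n" and eq: "\<And>y. y \<in> W \<Longrightarrow> f y = g y"
    and der: "((\<lambda>t. f (x(i := t))) has_real_derivative d) (at (x i))"
  shows "((\<lambda>t. g (x(i := t))) has_real_derivative d) (at (x i))"
proof (rule has_field_derivative_transform_within_open[OF der])
  show "open {t. x(i := t) \<in> W}"
    using W openin_subset[OF W(1)] by (intro open_coordinate_line) auto
qed (use W eq in auto)

lemma Ck_on_imp_continuous_map:
  "Ck_on n k U f \<Longrightarrow> continuous_map (subtopology (Euclidean_space n) U) euclideanreal f"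
  by (cases k) auto

lemma Ck_on_SucE:
  assumes "Ck_on n (Suc k) U f" "i < n"
  obtains g where "\<And>x. x \<in> U \<Longrightarrow> ((\<lambda>t. f (x(i := t))) has_real_derivative g x) (at (x i))"
    "Ck_on n k U g"
proof -
  have "\<exists>g. (\<forall>x\<in>U. ((\<lambda>t. f (x(i := t))) has_real_derivative g x) (at (x i))) \<and> Ck_on n k U g"
    using assms by simp
  then show thesis
    using that by blast
qed

lemma Ck_on_subset:
  assumes "Ck_on n k U f" "W \<subseteq> U"
  shows "Ck_on n k W f"
  using assms(1)
proof (induction k arbitrary: f)
  case 0
  then show ?case
    using continuous_map_from_subtopology_mono[OF Ck_on_imp_continuous_map[OF 0] assms(2)] by simp
next
  case (Suc k)
  have "continuous_map (subtopology (Euclidean_space n) W) euclideanreal f"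
    using continuous_map_from_subtopology_mono[OF Ck_on_imp_continuous_map[OF Suc.prems] assms(2)] .
  moreover have "\<exists>g. (\<forall>x\<in>W. ((\<lambda>t. f (x(i := t))) has_real_derivative g x) (at (x i))) \<and> Ck_on n k W g"
    if i: "i < n" for i
  proof -
    obtain g where "\<And>x. x \<in> U \<Longrightarrow> ((\<lambda>t. f (x(i := t))) has_real_derivative g x) (at (x i))"
        and "Ck_on n k U g"
      using Ck_on_SucE[OF Suc.prems i] by blast
    then show ?thesis
      using Suc.IH[of g] assms(2) by (intro exI[of _ g]) auto
  qed
  ultimately show ?case
    by simp
qed

lemma Ck_on_cong:
  assumes W: "openin (Euclidean_space n) W" and eq: "\<And>x. x \<in> W \<Longrightarrow> f x = g x" and Ck: "Ck_on n k W f"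
  shows "Ck_on n k W g"
proof -
  have cont: "continuous_map (subtopology (Euclidean_space n) W) euclideanreal g"
    by (rule continuous_map_eq[OF Ck_on_imp_continuous_map[OF Ck]]) (simp add: eq)
  show ?thesis
  proof (cases k)
    case (Suc j)
    have "\<exists>h. (\<forall>x\<in>W. ((\<lambda>t. g (x(i := t))) has_real_derivative h x) (at (x i))) \<and> Ck_on n j W h"
      if i: "i < n" for i
    proof -
      obtain h where h: "\<And>x. x \<in> W \<Longrightarrow> ((\<lambda>t. f (x(i := t))) has_real_derivative h x) (at (x i))"
          and Ck_h: "Ck_on n j W h"
        using Ck_on_SucE[OF Ck[unfolded Suc] i] by blast
      have "((\<lambda>t. g (x(i := t))) has_real_derivative h x) (at (x i))" if x: "x \<in> W" for x
        by (rule has_real_derivative_coordinate_cong[OF W x i eq h[OF x]])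
      then show ?thesis
        using Ck_h by blast
    qed
    with cont Suc show ?thesis
      by simp
  qed (simp add: cont)
qed

lemma Ck_on_const: "Ck_on n k U (\<lambda>x. c)"
proof (induction k arbitrary: c)
  case (Suc k)
  then show ?case
    by (auto intro!: exI[of _ "\<lambda>x. 0"])
qed simp

lemma continuous_map_local:
  assumes "openin T U"
    and "\<And>x. x \<in> U \<Longrightarrow> \<exists>W. openin T W \<and> x \<in> W \<and> W \<subseteq> U \<and> continuous_map (subtopology T W) T' f"
  shows "continuous_map (subtopology T U) T' f"
proof -
  obtain W where W: "\<And>x. x \<in> U \<Longrightarrow> openin T (W x) \<and> x \<in> W x \<and> W x \<subseteq> U \<and>
      continuous_map (subtopology T (W x)) T' f"
    using assms(2) by metis
  show ?thesis
  proof (rule pasting_lemma[where I = U and T = W and f = "\<lambda>_. f"])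
    show "openin (subtopology T U) (W x)" if "x \<in> U" for x
      using W[OF that] by (simp add: openin_open_subtopology assms(1))
    show "continuous_map (subtopology (subtopology T U) (W x)) T' f" if "x \<in> U" for x
      using W[OF that] by (simp add: subtopology_subtopology inf.absorb2)
    show "\<exists>j. j \<in> U \<and> x \<in> W j \<and> f x = f x" if "x \<in> topspace (subtopology T U)" for x
      using W that by auto
  qed auto
qed

text \<open>
  The local hypotheses provide unrelated partial derivatives on the various open sets; they fit
  together because each of them equals the actual derivative of the restriction to a coordinate
  line.
\<close>

lemma Ck_on_local:
  assumes "openin (Euclidean_space n) U"
    and "\<And>x. x \<in> U \<Longrightarrow> \<exists>W. openin (Euclidean_space n) W \<and> x \<in> W \<and> W \<subseteq> U \<and> Ck_on n k W f"
  shows "Ck_on n k U f"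
  using assms(2)
proof (induction k arbitrary: f)
  case 0
  have "continuous_map (subtopology (Euclidean_space n) U) euclideanreal f"
    using continuous_map_local[OF assms(1) 0[unfolded Ck_on.simps]] .
  then show ?case
    by simp
next
  case (Suc k)
  have "continuous_map (subtopology (Euclidean_space n) U) euclideanreal f"
    by (rule continuous_map_local[OF assms(1)]) (meson Suc.prems Ck_on_imp_continuous_map)
  moreover have "\<exists>g. (\<forall>x\<in>U. ((\<lambda>t. f (x(i := t))) has_real_derivative g x) (at (x i))) \<and> Ck_on n k U g"
    if i: "i < n" for i
  proof -
    define g where "g x = deriv (\<lambda>t. f (x(i := t))) (x i)" for x
    have loc: "\<exists>W. openin (Euclidean_space n) W \<and> x \<in> W \<and> W \<subseteq> U \<and> Ck_on n k W g \<and>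
        ((\<lambda>t. f (x(i := t))) has_real_derivative g x) (at (x i))" if x: "x \<in> U" for x
    proof -
      obtain W where W: "openin (Euclidean_space n) W" "x \<in> W" "W \<subseteq> U" "Ck_on n (Suc k) W f"
        using Suc.prems[OF x] by blast
      obtain h where h: "\<And>y. y \<in> W \<Longrightarrow> ((\<lambda>t. f (y(i := t))) has_real_derivative h y) (at (y i))"
          and Ck_h: "Ck_on n k W h"
        using Ck_on_SucE[OF W(4) i] by blast
      have eq: "h y = g y" if "y \<in> W" for y
        unfolding g_def by (rule DERIV_imp_deriv[OF h[OF that], symmetric])
      have "Ck_on n k W g"
        by (rule Ck_on_cong[OF W(1) eq Ck_h])
      moreover have "((\<lambda>t. f (x(i := t))) has_real_derivative g x) (at (x i))"
        using h[OF W(2)] eq[OF W(2)] by simp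
      ultimately show ?thesis
        using W by blast
    qed
    have "Ck_on n k U g"
      by (rule Suc.IH) (meson loc)
    moreover have "\<forall>x\<in>U. ((\<lambda>t. f (x(i := t))) has_real_derivative g x) (at (x i))"
      using loc by blast
    ultimately show ?thesis
      by blast
  qed
  ultimately show ?case by simp
qed

lemma Ck_on_imp_diff_upto_coordinate_line:
  assumes "openin (Euclidean_space n) U" "x \<in> topspace (Euclidean_space n)" "i < n" "Ck_on n k U f"
  shows "diff_upto k {t. x(i := t) \<in> U} (\<lambda>t. f (x(i := t)))"
  using assms(4)
proof (induction k arbitrary: f)
  case (Suc k)
  obtain g where g: "\<And>y. y \<in> U \<Longrightarrow> ((\<lambda>t. f (y(i := t))) has_real_derivative g y) (at (y i))"
      and Ck: "Ck_on n k U g"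
    using Ck_on_SucE[OF Suc.prems \<open>i < n\<close>] by blast
  have "((\<lambda>t. f (x(i := t))) has_real_derivative g (x(i := t))) (at t)" if "t \<in> {t. x(i := t) \<in> U}" for t
    using g[of "x(i := t)"] that by simp
  then show ?case
    by (rule diff_upto_SucI[OF open_coordinate_line[OF assms(1-3)] _ Suc.IH[OF Ck]])
qed simp

lemma continuous_map_Euclidean_space_component:
  "continuous_map (subtopology (Euclidean_space n) U) euclideanreal (\<lambda>x. x i)"
  unfolding Euclidean_space_def subtopology_subtopology
  by (intro continuous_map_from_subtopology continuous_map_product_projection) simp

lemma Ck_on_component: "Ck_on n k U (\<lambda>x. x j)"
proof (cases k)
  case (Suc m)
  have "((\<lambda>t. (x(i := t)) j) has_real_derivative (if i = j then 1 else 0)) (at (x i))" for x :: "nat \<Rightarrow> real" and i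
    by auto
  then have "\<exists>g. (\<forall>x\<in>U. ((\<lambda>t. (x(i := t)) j) has_real_derivative g x) (at (x i))) \<and> Ck_on n m U g" for i
    using Ck_on_const[of n m U] by (intro exI[of _ "\<lambda>x. if i = j then 1 else 0"]) blast
  then show ?thesis
    using Suc continuous_map_Euclidean_space_component by simp
qed (simp add: continuous_map_Euclidean_space_component)

text \<open>
  Membership of products in \<open>F\<close> needs multiplication to be smooth as a function on the plane;
  distinct indices make both partial derivatives coordinate functions.
\<close>

lemma Ck_on_component_mult: 
  assumes "i \<noteq> j"
  shows "Ck_on n k U (\<lambda>x. x i * x j)"
proof -
  have cont: "continuous_map (subtopology (Euclidean_space n) U) euclideanreal (\<lambda>x. x i * x j)"
    by (intro continuous_map_real_mult continuous_map_Euclidean_space_component)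
  show ?thesis
  proof (cases k)
    case (Suc m)
    have "\<exists>g. (\<forall>x\<in>U. ((\<lambda>t. (x(l := t)) i * (x(l := t)) j) has_real_derivative g x) (at (x l)))
           \<and> Ck_on n m U g" for l
    proof -
      consider "l = i" | "l = j" | "l \<noteq> i" "l \<noteq> j" by blast
      then show ?thesis
      proof cases
        case 1
        then show ?thesis using assms
          by (intro exI[of _ "\<lambda>x. x j"]) (auto intro!: derivative_eq_intros Ck_on_component)
      next
        case 2
        then show ?thesis using assms
          by (intro exI[of _ "\<lambda>x. x i"]) (auto intro!: derivative_eq_intros Ck_on_component)
      next
        case 3
        then show ?thesis 
          by (intro exI[of _ "\<lambda>x. 0"]) (auto intro!: Ck_on_const)
      qed
    qed
    with cont Suc show ?thesis by simp
  qed (simp add: cont)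
qed

lemma Ck_on_smooth_real_component:
  assumes "smooth_real b"
  shows "Ck_on n k U (\<lambda>x. b (x j))"
  using assms
proof (induction k arbitrary: b)
  case 0
  have "continuous_on UNIV b"
    using smooth_real_imp_DERIV[OF 0] by (meson DERIV_isCont continuous_at_imp_continuous_on)
  then have "continuous_map (subtopology (Euclidean_space n) U) euclideanreal (b \<circ> (\<lambda>x. x j))"
    by (intro continuous_map_compose[OF continuous_map_Euclidean_space_component]) auto
  then show ?case by (simp add: o_def)
next
  case (Suc k)
  have "continuous_on UNIV b"
    using smooth_real_imp_DERIV[OF Suc.prems] by (meson DERIV_isCont continuous_at_imp_continuous_on)
  then have "continuous_map (subtopology (Euclidean_space n) U) euclideanreal (b \<circ> (\<lambda>x. x j))"
    by (intro continuous_map_compose[OF continuous_map_Euclidean_space_component]) auto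
  moreover have "\<exists>g. (\<forall>x\<in>U. ((\<lambda>t. b ((x(i := t)) j)) has_real_derivative g x) (at (x i))) \<and> Ck_on n k U g" for i
  proof (cases "i = j")
    case True
    then show ?thesis
      using Suc.IH[OF smooth_real_deriv[OF Suc.prems]] smooth_real_imp_DERIV[OF Suc.prems]
      by (intro exI[of _ "\<lambda>x. deriv b (x j)"]) auto
  next
    case False
    then show ?thesis
      by (intro exI[of _ "\<lambda>x. 0"]) (auto intro!: Ck_on_const)
  qed
  ultimately show ?case by (simp add: o_def)
qed

text \<open>
  Basic open sets of the product topology have arbitrary open factors; they are shrunk here to
  intervals, so that changing one coordinate at a time, along a segment, stays inside the box.
\<close>

lemma Euclidean_space_box_neighbourhood:
  assumes W: "openin (Euclidean_space n) W" and "x \<in> W"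
  obtains B where "openin (Euclidean_space n) {y \<in> topspace (Euclidean_space n). \<forall>i<n. y i \<in> B i}"
    "\<And>i. i < n \<Longrightarrow> x i \<in> B i" "\<And>i. i < n \<Longrightarrow> is_interval (B i)"
    "{y \<in> topspace (Euclidean_space n). \<forall>i<n. y i \<in> B i} \<subseteq> W"
proof -
  obtain T where T: "openin (powertop_real UNIV) T" "W = T \<inter> {x. \<forall>i\<ge>n. x i = 0}"
    using W unfolding Euclidean_space_def openin_subtopology by blast
  then obtain A where A: "\<And>i. open (A i)" "x \<in> Pi\<^sub>E UNIV A" "Pi\<^sub>E UNIV A \<subseteq> T"
    using \<open>x \<in> W\<close> by (auto simp: openin_product_topology_alt) metis
  then have "\<forall>i. \<exists>e>0. ball (x i) e \<subseteq> A i"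
    by (meson PiE_E UNIV_I openE)
  then obtain e where e: "\<And>i. 0 < e i" "\<And>i. ball (x i) (e i) \<subseteq> A i"
    by metis
  define B where "B i = ball (x i) (e i)" for i
  have x0: "x i = 0" if "i \<ge> n" for i
    using T \<open>x \<in> W\<close> that by auto
  show thesis
  proof
    have "openin (powertop_real UNIV) (Pi\<^sub>E UNIV (\<lambda>i. if i < n then B i else UNIV))"
      by (rule product_topology_basis)
        (auto simp: B_def intro: finite_subset[of _ "{..<n}"] split: if_splits)
    moreover have "{y \<in> topspace (Euclidean_space n). \<forall>i<n. y i \<in> B i} =
        Pi\<^sub>E UNIV (\<lambda>i. if i < n then B i else UNIV) \<inter> {x. \<forall>i\<ge>n. x i = 0}"
      by (auto simp: topspace_Euclidean_space PiE_def Pi_def split: if_splits)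
    ultimately show "openin (Euclidean_space n) {y \<in> topspace (Euclidean_space n). \<forall>i<n. y i \<in> B i}"
      unfolding Euclidean_space_def openin_subtopology by auto
    show "{y \<in> topspace (Euclidean_space n). \<forall>i<n. y i \<in> B i} \<subseteq> W"
    proof
      fix y assume y: "y \<in> {y \<in> topspace (Euclidean_space n). \<forall>i<n. y i \<in> B i}"
      have "y i \<in> A i" for i
        using y e x0 by (cases "i < n") (force simp: B_def topspace_Euclidean_space)+
      then have "y \<in> T"
        using A(3) by auto
      then show "y \<in> W"
        using y T(2) by (auto simp: topspace_Euclidean_space)
    qed
  qed (auto simp: B_def e is_interval_ball_real)
qed


section \<open>Smooth path components\<close>

text \<open>
  As for \<^const>\<open>smoothly_path_connected\<close>, the curve is defined on the whole line and has to stay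
  in \<open>U\<close> at all times, not only between \<open>0\<close> and \<open>1\<close>.
\<close>

definition smoothly_joined :: "('a \<Rightarrow> real) set \<Rightarrow> 'a set \<Rightarrow> 'a \<Rightarrow> 'a \<Rightarrow> bool" where
  "smoothly_joined F U y z \<longleftrightarrow>
     (\<exists>\<gamma> :: real \<Rightarrow> 'a. (\<forall>t. \<gamma> t \<in> U) \<and> \<gamma> 0 = y \<and> \<gamma> 1 = z \<and> (\<forall>f\<in>F. smooth_real (\<lambda>t. f (\<gamma> t))))"

lemma smoothly_joinedI:
  assumes "\<And>t. \<gamma> t \<in> U" "\<gamma> 0 = y" "\<gamma> 1 = z" "\<And>f. f \<in> F \<Longrightarrow> smooth_real (\<lambda>t. f (\<gamma> t))"
  shows "smoothly_joined F U y z"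
  unfolding smoothly_joined_def using assms by (intro exI[of _ \<gamma>]) auto

lemma smoothly_joined_in: "smoothly_joined F U y z \<Longrightarrow> z \<in> U"
  unfolding smoothly_joined_def by metis

lemma smoothly_joined_refl: "y \<in> U \<Longrightarrow> smoothly_joined F U y y"
  by (rule smoothly_joinedI[of "\<lambda>_. y"]) (auto intro: smooth_real_const)

lemma smoothly_joined_affine:
  assumes "\<And>t. \<gamma> t \<in> U" "\<And>f. f \<in> F \<Longrightarrow> smooth_real (\<lambda>t. f (\<gamma> t))"
  shows "smoothly_joined F U (\<gamma> a) (\<gamma> b)"
proof (rule smoothly_joinedI[of "\<lambda>t. \<gamma> (a + (b - a) * t)"])
  show "smooth_real (\<lambda>t. f (\<gamma> (a + (b - a) * t)))" if "f \<in> F" for f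
    by (rule smooth_real_compose[OF assms(2)[OF that] smooth_real_affine])
qed (simp_all add: assms(1))

lemma smoothly_joined_sym:
  assumes "smoothly_joined F U y z"
  shows "smoothly_joined F U z y"
proof -
  obtain \<gamma> where "\<forall>t. \<gamma> t \<in> U" "\<gamma> 0 = y" "\<gamma> 1 = z" "\<forall>f\<in>F. smooth_real (\<lambda>t. f (\<gamma> t))"
    using assms unfolding smoothly_joined_def by blast
  note g = this[rule_format]
  show ?thesis
    using smoothly_joined_affine[of \<gamma> U F 1 0, OF g(1,4)] by (simp add: g(2,3))
qed

text \<open>
  Both curves are reparametrised by a smooth step, so that the first one rests in \<open>y\<close> for
  \<open>t \<ge> 1/4\<close> and the second one for \<open>t \<le> 1/2\<close>. The concatenation is then smooth because it
  coincides with one of the two curves on each of the overlapping open half-lines \<open>t < 1/2\<close> and \<open>t > 1/4\<close>.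
\<close>

lemma smoothly_joined_trans:
  assumes "smoothly_joined F U x y" "smoothly_joined F U y z"
  shows "smoothly_joined F U x z"
proof -
  obtain \<gamma> where "\<forall>t. \<gamma> t \<in> U" "\<gamma> 0 = x" "\<gamma> 1 = y" "\<forall>f\<in>F. smooth_real (\<lambda>t. f (\<gamma> t))"
    using assms(1) unfolding smoothly_joined_def by blast
  note g = this[rule_format]
  obtain \<eta> where "\<forall>t. \<eta> t \<in> U" "\<eta> 0 = y" "\<eta> 1 = z" "\<forall>f\<in>F. smooth_real (\<lambda>t. f (\<eta> t))"
    using assms(2) unfolding smoothly_joined_def by blast
  note h = this[rule_format]
  obtain s :: "real \<Rightarrow> real" where s: "smooth_real s" "\<And>t. t \<le> 0 \<Longrightarrow> s t = 0" "\<And>t. 1/2 \<le> t \<Longrightarrow> s t = 1"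
    using smooth_step_exists by blast
  define \<delta> where "\<delta> t = (if t \<le> 1/2 then \<gamma> (s (0 + 2 * t)) else \<eta> (s (- 1 + 2 * t)))" for t
  have left: "\<delta> t = \<gamma> (s (0 + 2 * t))" if "t \<in> {..<1/2}" for t
    using that by (simp add: \<delta>_def)
  have right: "\<delta> t = \<eta> (s (- 1 + 2 * t))" if "t \<in> {1/4<..}" for t
    using that s(2)[of "- 1 + 2 * t"] s(3)[of "0 + 2 * t"] by (auto simp: \<delta>_def g h)
  show ?thesis
  proof (rule smoothly_joinedI[of \<delta>])
    fix f assume f: "f \<in> F"
    have "diff_upto k UNIV (\<lambda>t. f (\<delta> t))" for k
    proof -
      have "smooth_real (\<lambda>t. f (\<gamma> (s (0 + 2 * t))))" "smooth_real (\<lambda>t. f (\<eta> (s (- 1 + 2 * t))))"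
        by (rule smooth_real_compose[OF g(4)[OF f] smooth_real_compose[OF s(1) smooth_real_affine]]
          smooth_real_compose[OF h(4)[OF f] smooth_real_compose[OF s(1) smooth_real_affine]])+
      then have l: "diff_upto k {..<1/2} (\<lambda>t. f (\<gamma> (s (0 + 2 * t))))"
          and r: "diff_upto k {1/4<..} (\<lambda>t. f (\<eta> (s (- 1 + 2 * t))))"
        unfolding smooth_real_iff_diff_upto using diff_upto_subset[OF _ subset_UNIV] by blast+
      have "diff_upto k {..<1/2} (\<lambda>t. f (\<delta> t))"
        by (rule diff_upto_cong[OF open_lessThan _ l]) (simp only: left)
      moreover have "diff_upto k {1/4<..} (\<lambda>t. f (\<delta> t))"
        by (rule diff_upto_cong[OF open_greaterThan _ r]) (simp only: right)
      ultimately have "diff_upto k ({..<1/2} \<union> {1/4<..}) (\<lambda>t. f (\<delta> t))"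
        by (rule diff_upto_Un)
      moreover have "{..<1/2} \<union> {1/4<..} = (UNIV :: real set)"
        by auto
      ultimately show ?thesis
        by simp
    qed
    then show "smooth_real (\<lambda>t. f (\<delta> t))"
      by (simp add: smooth_real_iff_diff_upto)
  qed (use g h s in \<open>auto simp: \<delta>_def\<close>)
qed

text \<open>
  A curve inside \<open>U\<close> that starts in the component never leaves it, as its rescaled initial
  pieces join its points to its origin. So curves in \<open>U\<close> between points of the component
  witness path-connectedness of the component itself.
\<close>

lemma smoothly_path_connected_component:
  assumes "U \<subseteq> X"
  shows "smoothly_path_connected X F {y. smoothly_joined F U x y}"
  unfolding smoothly_path_connected_def
proof (intro conjI ballI)
  show "{y. smoothly_joined F U x y} \<subseteq> X"
    using assms by (auto dest: smoothly_joined_in)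
  fix y z assume "y \<in> {y. smoothly_joined F U x y}" "z \<in> {y. smoothly_joined F U x y}"
  then have y: "smoothly_joined F U x y" and z: "smoothly_joined F U x z"
    by auto
  have "smoothly_joined F U y z"
    by (rule smoothly_joined_trans[OF smoothly_joined_sym[OF y] z])
  then obtain \<gamma> where "\<forall>t. \<gamma> t \<in> U" "\<gamma> 0 = y" "\<gamma> 1 = z" "\<forall>f\<in>F. smooth_real (\<lambda>t. f (\<gamma> t))"
    unfolding smoothly_joined_def by blast
  note g = this[rule_format]
  have "smoothly_joined F U x (\<gamma> t)" for t
  proof (rule smoothly_joined_trans[OF y])
    show "smoothly_joined F U y (\<gamma> t)"
      using smoothly_joined_affine[of \<gamma> U F 0 t, OF g(1,4)] unfolding g(2) .
  qed
  then have "range \<gamma> \<subseteq> {y. smoothly_joined F U x y}"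
    by auto
  moreover have "\<forall>f\<in>F. smooth_real (f \<circ> \<gamma>)"
    unfolding o_def by (intro ballI g(4))
  ultimately show "\<exists>\<gamma> :: real \<Rightarrow> 'a. range \<gamma> \<subseteq> {y. smoothly_joined F U x y} \<and> \<gamma> 0 = y \<and> \<gamma> 1 = z \<and>
      (\<forall>f\<in>F. smooth_real (f \<circ> \<gamma>))"
    using g(2,3) by (intro exI[of _ \<gamma>] conjI)
qed

section \<open>Plots\<close>

lemma Pi_paramD:
  assumes "(n, D, p) \<in> Pi_param X F"
  shows "openin (Euclidean_space n) D" "\<And>u. u \<in> D \<Longrightarrow> p u \<in> X" "\<And>u. u \<notin> D \<Longrightarrow> p u = undefined"
    "\<And>f k. f \<in> F \<Longrightarrow> Ck_on n k D (\<lambda>u. f (p u))"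
  using assms by (auto simp: Pi_param_def parametrisations_def smooth_on_def o_def PiE_def extensional_def Pi_def)

text \<open>
  Plots are continuous: this holds on the generating sets of the initial topology because \<open>f \<circ> p\<close> is
  continuous for every \<open>f \<in> F\<close>.
\<close>

lemma openin_plot_preimage:
  assumes p: "(n, D, p) \<in> Pi_param X F" and U: "openin (initial_topology X F) U"
  shows "openin (Euclidean_space n) {u \<in> D. p u \<in> U}"
proof -
  note D = Pi_paramD[OF p]
  have top: "topspace (subtopology (Euclidean_space n) D) = D"
    using openin_subset[OF D(1)] by auto
  have "continuous_map (subtopology (Euclidean_space n) D) (initial_topology X F) p"
    unfolding initial_topology_def continuous_on_generated_topo_iff top
  proof (intro conjI allI impI)
    fix B assume "B \<in> insert X {{x \<in> X. f x \<in> S} |f S. f \<in> F \<and> open S}"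
    then consider "B = X" | f S where "f \<in> F" "open S" "B = {x \<in> X. f x \<in> S}"
      by blast
    then show "openin (subtopology (Euclidean_space n) D) (p -` B \<inter> D)"
    proof cases
      case 1
      then have "p -` B \<inter> D = D"
        using D(2) by auto
      then show ?thesis
        using D(1) by (simp add: openin_open_subtopology)
    next
      case 2
      have "openin (subtopology (Euclidean_space n) D)
          {u \<in> topspace (subtopology (Euclidean_space n) D). f (p u) \<in> S}"
        by (rule openin_continuous_map_preimage[OF Ck_on_imp_continuous_map[OF D(4)[OF 2(1), of 0]]])
          (use 2 in simp)
      moreover have "p -` B \<inter> D = {u \<in> D. f (p u) \<in> S}"
        using D(2) 2 by auto
      ultimately show ?thesis
        unfolding top by simp
    qed
  qed (use D(2) in auto)
  from openin_continuous_map_preimage[OF this U] show ?thesis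
    unfolding top using openin_trans_full[OF _ D(1)] by blast
qed

text \<open>
  The segment is traversed with the speed given by a smooth step, so that the curve is defined for all times
  without leaving the segment. Composed with \<open>f \<in> F\<close> it becomes a smooth function of one
  variable, the restriction of \<open>f \<circ> p\<close> to a coordinate line, after a smooth reparametrisation.
\<close>

lemma smoothly_joined_plot_coordinate:
  assumes p: "(n, D, p) \<in> Pi_param X F"
    and W: "openin (Euclidean_space n) W" "W \<subseteq> D" "\<And>u. u \<in> W \<Longrightarrow> p u \<in> U"
    and u: "u \<in> W" "i < n" and seg: "\<And>r. r \<in> closed_segment (u i) a \<Longrightarrow> u(i := r) \<in> W"
  shows "smoothly_joined F U (p u) (p (u(i := a)))"
proof -
  obtain s :: "real \<Rightarrow> real" where s: "smooth_real s" "\<And>t. t \<le> 0 \<Longrightarrow> s t = 0" "\<And>t. 1/2 \<le> t \<Longrightarrow> s t = 1"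
      "\<And>t. 0 \<le> s t \<and> s t \<le> 1"
    using smooth_step_exists by blast
  define r where "r t = u i + (a - u i) * s t" for t
  have r_seg: "r t \<in> closed_segment (u i) a" for t
    unfolding in_segment r_def by (rule exI[of _ "s t"]) (use s(4)[of t] in \<open>auto simp: algebra_simps\<close>)
  have u_top: "u \<in> topspace (Euclidean_space n)"
    using openin_subset[OF W(1)] u(1) by blast
  show ?thesis
  proof (rule smoothly_joinedI[of "\<lambda>t. p (u(i := r t))"])
    fix f assume f: "f \<in> F"
    have "diff_upto k UNIV (\<lambda>t. f (p (u(i := r t))))" for k
    proof (rule diff_upto_compose[where f = "\<lambda>t. f (p (u(i := t)))" and s = r])
      show "open {t. u(i := t) \<in> W}"
        by (rule open_coordinate_line[OF W(1) u_top u(2)])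
      show "r ` UNIV \<subseteq> {t. u(i := t) \<in> W}"
        using seg r_seg by blast
      show "diff_upto k {t. u(i := t) \<in> W} (\<lambda>t. f (p (u(i := t))))"
        by (rule Ck_on_imp_diff_upto_coordinate_line[OF W(1) u_top u(2) Ck_on_subset[OF Pi_paramD(4)[OF p f] W(2)]])
      show "diff_upto k UNIV r"
        using smooth_real_compose[OF smooth_real_affine s(1), of "u i" "a - u i"]
        unfolding r_def smooth_real_iff_diff_upto by blast
    qed simp
    then show "smooth_real (\<lambda>t. f (p (u(i := r t))))"
      by (simp add: smooth_real_iff_diff_upto)
  qed (use W(3) seg r_seg s(2)[of 0] s(3)[of 1] in \<open>auto simp: r_def\<close>)
qed

lemma smoothly_joined_plot_box:
  fixes B :: "nat \<Rightarrow> real set"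
  assumes p: "(n, D, p) \<in> Pi_param X F"
    and W_def: "W = {y \<in> topspace (Euclidean_space n). \<forall>i<n. y i \<in> B i}"
    and B: "\<And>i. i < n \<Longrightarrow> is_interval (B i)"
    and W: "openin (Euclidean_space n) W" "W \<subseteq> D" "\<And>u. u \<in> W \<Longrightarrow> p u \<in> U"
    and u: "u \<in> W" and v: "v \<in> W"
  shows "smoothly_joined F U (p u) (p v)"
proof -
  \<comment> \<open>The corners of the chain from \<open>u\<close> to \<open>v\<close>: the first \<open>j\<close> coordinates have been changed.\<close>
  define w where "w j = (\<lambda>i. if i < j then v i else u i)" for j
  have w_W: "w j \<in> W" for j
    using u v by (auto simp: w_def W_def topspace_Euclidean_space)
  have "smoothly_joined F U (p u) (p (w j))" if "j \<le> n" for j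
    using that
  proof (induction j)
    case 0
    have "w 0 = u"
      by (simp add: w_def)
    then show ?case
      using smoothly_joined_refl W(3)[OF u] by simp
  next
    case (Suc j)
    then have j: "j < n" by simp
    have "smoothly_joined F U (p (w j)) (p ((w j)(j := v j)))"
    proof (rule smoothly_joined_plot_coordinate[OF p W w_W j])
      fix r assume r: "r \<in> closed_segment (w j j) (v j)"
      have "convex (B j)"
        using B[OF j] by (simp add: is_interval_convex)
      moreover have "w j j \<in> B j" "v j \<in> B j"
        using w_W[of j] v j by (auto simp: W_def)
      ultimately have "r \<in> B j"
        using closed_segment_subset r by blast
      then show "(w j)(j := r) \<in> W"
        using w_W[of j] j by (auto simp: W_def topspace_Euclidean_space)
    qed
    moreover have "(w j)(j := v j) = w (Suc j)"
      by (auto simp: w_def)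
    ultimately show ?case
      using smoothly_joined_trans[OF Suc.IH] j by auto
  qed
  moreover have "w n = v"
    using u v by (auto simp: w_def W_def topspace_Euclidean_space fun_eq_iff)
  ultimately show ?thesis
    by force
qed

section \<open>Localisation in a differential space\<close>

lemma differential_space_compose:
  assumes "smooth_compatibility X F" "f \<in> F" "smooth_real b"
  shows "(\<lambda>x\<in>X. b (f x)) \<in> F"
proof -
  have "smooth_on 1 (topspace (Euclidean_space 1)) (\<lambda>x. b (x 0))"
    by (simp add: smooth_on_def Ck_on_smooth_real_component assms(3) del: topspace_Euclidean_space)
  then show ?thesis
    using assms(1)[unfolded smooth_compatibility_def, rule_format, of 1 "\<lambda>_. f" "\<lambda>x. b (x 0)"]
      assms(2) by simp
qed

lemma differential_space_mult:
  assumes "smooth_compatibility X F" "f \<in> F" "g \<in> F"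
  shows "(\<lambda>x\<in>X. f x * g x) \<in> F"
proof -
  have "smooth_on 2 (topspace (Euclidean_space 2)) (\<lambda>x. x 0 * x 1)"
    by (simp add: smooth_on_def Ck_on_component_mult)
  moreover have "\<forall>i<2. (if i = 0 then f else g) \<in> F"
    using assms(2,3) by simp
  ultimately show ?thesis
    using assms(1)[unfolded smooth_compatibility_def, rule_format, of 2 "\<lambda>i. if i = 0 then f else g"
        "\<lambda>x. x 0 * x 1"] by simp
qed

lemma openin_initial_topology_vimage:
  assumes "f \<in> F" "open S"
  shows "openin (initial_topology X F) {y \<in> X. f y \<in> S}"
  using openin_continuous_map_preimage[OF continuous_map_initial_topology[OF assms(1)], of S] assms(2)
  by simp

text \<open>
  Vanishing merely outside \<open>U\<close> would not suffice later on, where a modification of \<open>g\<close> inside \<open>U\<close> must stay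
  smooth across the boundary of \<open>U\<close>; hence the open set \<open>V\<close>. The construction follows the
  generation of the topology: a bump function of the line composed with \<open>f \<in> F\<close> for a generating set, and
  products for intersections.
\<close>

lemma bump_function_exists:
  assumes F: "smooth_compatibility X F" "F \<noteq> {}"
    and "openin (initial_topology X F) U" "x \<in> U"
  shows "\<exists>g\<in>F. g x \<noteq> 0 \<and> (\<exists>V. openin (initial_topology X F) V \<and> X - U \<subseteq> V \<and> (\<forall>y\<in>V. g y = 0))"
proof -
  have "x \<in> X"
    using openin_subset[OF assms(3)] \<open>x \<in> U\<close> by auto
  have "generate_topology_on (insert X {{x \<in> X. f x \<in> S} |f S. f \<in> F \<and> open S}) U"
    using assms(3) by (simp add: initial_topology_def openin_topology_generated_by_iff)
  then show ?thesis
    using \<open>x \<in> U\<close>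
  proof (induction rule: generate_topology_on.induct)
    case Empty
    then show ?case by simp
  next
    case (Int U1 U2)
    obtain g1 V1 where 1: "g1 \<in> F" "g1 x \<noteq> 0" "openin (initial_topology X F) V1" "X - U1 \<subseteq> V1"
        "\<forall>y\<in>V1. g1 y = 0"
      using Int.IH(1) Int.prems by blast
    obtain g2 V2 where 2: "g2 \<in> F" "g2 x \<noteq> 0" "openin (initial_topology X F) V2" "X - U2 \<subseteq> V2"
        "\<forall>y\<in>V2. g2 y = 0"
      using Int.IH(2) Int.prems by blast
    have "(\<lambda>y\<in>X. g1 y * g2 y) \<in> F"
      by (rule differential_space_mult[OF F(1) 1(1) 2(1)])
    moreover have "openin (initial_topology X F) (V1 \<union> V2)"
      by (rule openin_Un[OF 1(3) 2(3)])
    moreover have "X - U1 \<inter> U2 \<subseteq> V1 \<union> V2"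
      using 1(4) 2(4) by blast
    moreover have "\<forall>y\<in>V1 \<union> V2. (\<lambda>y\<in>X. g1 y * g2 y) y = 0"
      using 1(5) 2(5) openin_subset[OF 1(3)] openin_subset[OF 2(3)] by auto
    moreover have "(\<lambda>y\<in>X. g1 y * g2 y) x \<noteq> 0"
      using 1(2) 2(2) \<open>x \<in> X\<close> by simp
    ultimately show ?case
      by blast
  next
    case (UN K)
    then obtain k where k: "k \<in> K" "x \<in> k"
      by blast
    from UN.IH[OF k] \<open>k \<in> K\<close> show ?case
      by blast
  next
    case (Basis S)
    then consider "S = X" | f T where "f \<in> F" "open T" "S = {y \<in> X. f y \<in> T}"
      by blast
    then show ?case
    proof cases
      case 1
      obtain f where "f \<in> F"
        using F(2) by blast
      then have "(\<lambda>y\<in>X. 1) \<in> F"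
        using differential_space_compose[OF F(1) _ smooth_real_const] by blast
      then show ?thesis
        using 1 \<open>x \<in> X\<close> by (intro bexI[of _ "\<lambda>y\<in>X. 1"]) (auto intro!: exI[of _ "{}"])
    next
      case 2
      then have "f x \<in> T"
        using Basis by blast
      then obtain e where e: "0 < e" "cball (f x) e \<subseteq> T"
        using open_contains_cball \<open>open T\<close> by blast
      obtain b where b: "smooth_real b" "b (f x) \<noteq> 0" "\<And>t. e / 2 < \<bar>t - f x\<bar> \<Longrightarrow> b t = 0"
        using smooth_bump_exists[of "e / 2" "f x"] e(1) by auto
      define V where "V = {y \<in> X. f y \<in> - cball (f x) (e / 2)}"
      have "openin (initial_topology X F) V"
        unfolding V_def by (rule openin_initial_topology_vimage) (use 2 in auto)
      moreover have "X - S \<subseteq> V"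
      proof
        fix y assume y: "y \<in> X - S"
        then have "f y \<notin> cball (f x) e"
          using 2 e(2) by blast
        then show "y \<in> V"
          using y e(1) by (auto simp: V_def)
      qed
      moreover have "\<forall>y\<in>V. (\<lambda>y\<in>X. b (f y)) y = 0"
        by (auto simp: V_def dist_real_def abs_minus_commute intro!: b(3))
      moreover have "(\<lambda>y\<in>X. b (f y)) x \<noteq> 0"
        using b(2) \<open>x \<in> X\<close> by simp
      ultimately show ?thesis
        using differential_space_compose[OF F(1) 2(1) b(1)] by blast
    qed
  qed
qed

theorem proposition6p6:
  fixes X :: "'a set" and F :: "('a \<Rightarrow> real) set"
  assumes "differential_space X F"
    and "reflexive X F"
  shows "locally_smoothly_path_connected X F"
  unfolding locally_smoothly_path_connected_iff
proof (intro ballI allI impI)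
  fix x U
  assume "x \<in> X" and "openin (initial_topology X F) U \<and> x \<in> U"
  then have U: "openin (initial_topology X F) U" and x: "x \<in> U"
    by auto
  have "U \<subseteq> X"
    using openin_subset[OF U] by simp
  have F: "smooth_compatibility X F" "F \<noteq> {}"
    using assms(1) by (simp_all add: differential_space_def)
  obtain g V where g: "g \<in> F" "g x \<noteq> 0" and V: "openin (initial_topology X F) V" "X - U \<subseteq> V"
      and gV: "\<And>y. y \<in> V \<Longrightarrow> g y = 0"
    using bump_function_exists[OF F U x] by blast
  define C where "C = {y. smoothly_joined F U x y}"
  define h where "h = (\<lambda>y\<in>X. if y \<in> C then g y else 0)"
  have "smooth_on n D (h \<circ> p)" if p: "(n, D, p) \<in> Pi_param X F" for n D p
    unfolding smooth_on_def
  proof (intro allI Ck_on_local Pi_paramD(1)[OF p])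
    fix k u assume u: "u \<in> D"
    show "\<exists>W. openin (Euclidean_space n) W \<and> u \<in> W \<and> W \<subseteq> D \<and> Ck_on n k W (h \<circ> p)"
    proof (cases "p u \<in> U")
      case True
      have "openin (Euclidean_space n) {w \<in> D. p w \<in> U}"
        by (rule openin_plot_preimage[OF p U])
      then obtain B where W_open: "openin (Euclidean_space n) {y \<in> topspace (Euclidean_space n). \<forall>i<n. y i \<in> B i}"
          and uB: "\<And>i. i < n \<Longrightarrow> u i \<in> B i" and B: "\<And>i. i < n \<Longrightarrow> is_interval (B i)"
          and sub: "{y \<in> topspace (Euclidean_space n). \<forall>i<n. y i \<in> B i} \<subseteq> {w \<in> D. p w \<in> U}"
        by (rule Euclidean_space_box_neighbourhood[of n "{w \<in> D. p w \<in> U}" u]) (use u True in auto)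
      \<comment> \<open>The box lies in the preimage of \<open>U\<close>, so its image lies either in \<open>C\<close> or in the complement of \<open>C\<close>.\<close>
      define W where "W = {y \<in> topspace (Euclidean_space n). \<forall>i<n. y i \<in> B i}"
      have W: "openin (Euclidean_space n) W" "W \<subseteq> D" "\<And>w. w \<in> W \<Longrightarrow> p w \<in> U"
        using W_open sub unfolding W_def by auto
      have "u \<in> W"
        using uB u openin_subset[OF Pi_paramD(1)[OF p]] unfolding W_def by auto
      have joined: "smoothly_joined F U (p u) (p w)" "smoothly_joined F U (p w) (p u)" if "w \<in> W" for w
        using smoothly_joined_plot_box[OF p W_def B W] that \<open>u \<in> W\<close> by auto
      have C_iff: "p w \<in> C \<longleftrightarrow> p u \<in> C" if "w \<in> W" for w
        unfolding C_def mem_Collect_eq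
        using smoothly_joined_trans[OF _ joined(1)[OF that]] smoothly_joined_trans[OF _ joined(2)[OF that]] by blast
      have "Ck_on n k W (\<lambda>w. if p u \<in> C then g (p w) else 0)"
        using Ck_on_subset[OF Pi_paramD(4)[OF p g(1)] W(2)] Ck_on_const by (cases "p u \<in> C") auto
      then have "Ck_on n k W (h \<circ> p)"
        by (rule Ck_on_cong[OF W(1), rotated])
          (use C_iff W(2) Pi_paramD(2)[OF p] in \<open>auto simp: h_def\<close>)
      with W \<open>u \<in> W\<close> show ?thesis
        by blast
    next
      case False
      define W where "W = {w \<in> D. p w \<in> V}"
      have W: "openin (Euclidean_space n) W"
        unfolding W_def by (rule openin_plot_preimage[OF p V(1)])
      have "Ck_on n k W (h \<circ> p)"
        by (rule Ck_on_cong[OF W _ Ck_on_const[of _ _ _ 0]])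
          (use gV Pi_paramD(2)[OF p] in \<open>auto simp: h_def W_def\<close>)
      moreover have "u \<in> W"
        using u False V(2) Pi_paramD(2)[OF p u] by (auto simp: W_def)
      ultimately show ?thesis
        using W by (auto simp: W_def)
    qed
  qed
  then have "h \<in> Phi X (Pi_param X F)"
    by (auto simp: Phi_def h_def)
  then have h: "h \<in> F"
    using assms(2) by (simp add: reflexive_def)
  show "\<exists>W V. openin (initial_topology X F) W \<and> smoothly_path_connected X F V \<and> x \<in> W \<and> W \<subseteq> V \<and> V \<subseteq> U"
  proof (intro exI conjI)
    show "openin (initial_topology X F) {y \<in> X. h y \<in> - {0}}"
      by (rule openin_initial_topology_vimage[OF h]) (rule open_Compl[OF closed_singleton])
    show "smoothly_path_connected X F C"
      unfolding C_def by (rule smoothly_path_connected_component[OF \<open>U \<subseteq> X\<close>])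
    show "x \<in> {y \<in> X. h y \<in> - {0}}"
      using \<open>x \<in> X\<close> g(2) smoothly_joined_refl[OF x] by (simp add: h_def C_def)
    show "{y \<in> X. h y \<in> - {0}} \<subseteq> C"
      by (auto simp: h_def)
    show "C \<subseteq> U"
      by (auto simp: C_def dest: smoothly_joined_in)
  qed
qed

end
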